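(* Let $X$ be a separated (Hausdorff) real topological linear space, let $(Z,\preceq)$ be a preordered set, and let $\Psi$ be a family of functions $\psi\colon Z\to\mathbb{R}\cup\{\pm\infty\}$ which are monotone with respect to $\preceq$. Let $f\colon X\to\mathcal{P}(Z,\Psi)$ be given. If $f$ is $(0,\Psi)$-well-posed, then $\operatorname{Min}(f,0,\Psi)$ is non-empty and a $(0,\Psi)$-solution for the problem: minimize $f(x)$ over $x\in X$. Moreover, $\operatorname{Min}(f,\varepsilon,\Psi)$ Hausdorff converges to $\operatorname{Min}(f,0,\Psi)$ for $\varepsilon\to0$.
   Context: A function $\psi\colon Z\to\mathbb{R}\cup\{\pm\infty\}$ is monotone if $z_1\preceq z_2$ implies $\psi(z_1)\le\psi(z_2)$. For $D\subseteq Z$, $\psi^\triangle(D)=\inf_{z\in D}\psi(z)$ (with $\inf_{z\in\emptyset}\psi(z)=+\infty$) and $\operatorname{cl}_\Psi D=\bigcap_{\psi\in\Psi}\{z\in Z\mid \psi^\triangle(D)\le\psi(z)\}$; $\mathcal{P}(Z,\Psi)=\{D\subseteq Z\mid D=\operatorname{cl}_\Psi D\}$, ordered by $\supseteq$, is a complete lattice in which $\inf\mathcal{A}=\operatorname{cl}_\Psi\bigcup_{A\in\mathcal{A}}A$. For $M\subseteq X$, $\inf f[M]=\operatorname{cl}_\Psi\bigcup_{x\in M}f(x)$. For $\varepsilon\ge 0$ and $\psi\in\Psi$ put $b_\varepsilon(\psi)=\psi^\triangle(\inf f[X])+\varepsilon$ if $\psi^\triangle(\inf f[X])\ne-\infty$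 and $b_\varepsilon(\psi)=-\frac1\varepsilon$ if $\psi^\triangle(\inf f[X])=-\infty$, with the conventions $-\frac10=-\infty$ and $+\infty+\varepsilon=+\infty$. An element $x\in X$ is an $(\varepsilon,\Psi)$-minimizer of $f$ if there exists $\psi\in\Psi$ with $\psi^\triangle(f(x))\le b_\varepsilon(\psi)$; the set of these is $\operatorname{Min}(f,\varepsilon,\Psi)$. A non-empty set $M\subseteq X$ is an $(\varepsilon,\Psi)$-solution of the problem if $\psi^\triangle(\inf f[M])\le b_\varepsilon(\psi)$ for all $\psi\in\Psi$ and $M\subseteq\operatorname{Min}(f,\varepsilon,\Psi)$. A net $\{M_i\}_{i\in I}$ of subsets of $X$ Hausdorff converges to $N\subseteq X$ if for every neighborhood $U$ of $0\in X$, eventually $M_i\subseteq N+U$ and $N\subseteq M_i+U$ (for a family indexed by $\varepsilon\to0$: for all sufficiently small $\varepsilon>0$). A net $\{M_i\}_{i\in I}$ of subsets of $X$ is $\Psi$-minimizing if for all $\varepsilon>0$ there is $i_\varepsilon\in I$ such that for all $i\ge i_\varepsilon$ the set $M_i$ is an $(\varepsilon,\Psi)$-solution. The function $f$ is $(0,\Psi)$-well-posed if a $(0,\Psi)$-solution exists and every $\Psi$-minimizing net has a Hausdorff convergent subnet converging to a $(0,\Psi)$-solution. *)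

theory Defs
  imports "HOL-Analysis.Analysis" "HOL-Library.Set_Algebras"
begin

class real_topological_vector = real_vector + topological_ab_group_add +
  assumes tendsto_scaleR_Pair:
    "LIM x (nhds a \<times>\<^sub>F nhds b). fst x *\<^sub>R snd x :> nhds (a *\<^sub>R b)"


section \<open>The lattice of closed sets generated by a family of functions\<close>

definition psi_inf :: "('z \<Rightarrow> ereal) \<Rightarrow> 'z set \<Rightarrow> ereal" where
  "psi_inf \<psi> D = (INF z\<in>D. \<psi> z)"

definition cl_Psi :: "('z \<Rightarrow> ereal) set \<Rightarrow> 'z set \<Rightarrow> 'z set" where
  "cl_Psi \<Psi> D = (\<Inter>\<psi>\<in>\<Psi>. {z. psi_inf \<psi> D \<le> \<psi> z})"

definition closed_family :: "('z \<Rightarrow> ereal) set \<Rightarrow> 'z set set" where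
  "closed_family \<Psi> = {D. D = cl_Psi \<Psi> D}"

text \<open>The infimum of \<open>f[M]\<close> in \<open>closed_family \<Psi>\<close> ordered by \<open>\<supseteq>\<close>.\<close>

definition inf_image :: "('z \<Rightarrow> ereal) set \<Rightarrow> ('x \<Rightarrow> 'z set) \<Rightarrow> 'x set \<Rightarrow> 'z set" where
  "inf_image \<Psi> f M = cl_Psi \<Psi> (\<Union>x\<in>M. f x)"


section \<open>Approximate minimizers and solutions\<close>

definition eps_bound ::
    "('z \<Rightarrow> ereal) set \<Rightarrow> ('x \<Rightarrow> 'z set) \<Rightarrow> real \<Rightarrow> ('z \<Rightarrow> ereal) \<Rightarrow> ereal" where
  "eps_bound \<Psi> f \<epsilon> \<psi> =
     (if psi_inf \<psi> (inf_image \<Psi> f UNIV) \<noteq> -\<infinity>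
      then psi_inf \<psi> (inf_image \<Psi> f UNIV) + ereal \<epsilon>
      else if \<epsilon> = 0 then -\<infinity> else ereal (- (1 / \<epsilon>)))"

definition Minimizers :: "('x \<Rightarrow> 'z set) \<Rightarrow> real \<Rightarrow> ('z \<Rightarrow> ereal) set \<Rightarrow> 'x set" where
  "Minimizers f \<epsilon> \<Psi> = {x. \<exists>\<psi>\<in>\<Psi>. psi_inf \<psi> (f x) \<le> eps_bound \<Psi> f \<epsilon> \<psi>}"

definition is_solution :: "('x \<Rightarrow> 'z set) \<Rightarrow> real \<Rightarrow> ('z \<Rightarrow> ereal) set \<Rightarrow> 'x set \<Rightarrow> bool" where
  "is_solution f \<epsilon> \<Psi> M \<longleftrightarrow>
     M \<noteq> {} \<and>
     (\<forall>\<psi>\<in>\<Psi>. psi_inf \<psi> (inf_image \<Psi> f M) \<le> eps_bound \<Psi> f \<epsilon> \<psi>) \<and>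
     M \<subseteq> Minimizers f \<epsilon> \<Psi>"


section \<open>Nets, subnets and Hausdorff convergence\<close>

text \<open>A net is a function restricted to an index set \<open>I\<close> directed by a preorder \<open>r\<close>,
  where \<open>(i, j) \<in> r\<close> means \<open>i \<le> j\<close>.\<close>

definition directed_by :: "'i set \<Rightarrow> 'i rel \<Rightarrow> bool" where
  "directed_by I r \<longleftrightarrow>
     I \<noteq> {} \<and> preorder_on I r \<and> (\<forall>i\<in>I. \<forall>j\<in>I. \<exists>k\<in>I. (i, k) \<in> r \<and> (j, k) \<in> r)"

definition tails :: "'i set \<Rightarrow> 'i rel \<Rightarrow> 'i filter" where
  "tails I r = (INF i\<in>I. principal {j. (i, j) \<in> r})"

lemma eventually_tails:
  assumes "directed_by I r"
  shows "eventually P (tails I r) \<longleftrightarrow> (\<exists>i\<in>I. \<forall>j. (i, j) \<in> r \<longrightarrow> P j)"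
proof -
  have *: "I \<noteq> {}" "trans r" "\<And>i j. i \<in> I \<Longrightarrow> j \<in> I \<Longrightarrow> \<exists>k\<in>I. (i, k) \<in> r \<and> (j, k) \<in> r"
    using assms by (auto simp: directed_by_def preorder_on_def)
  have "eventually P (tails I r) \<longleftrightarrow> (\<exists>i\<in>I. eventually P (principal {j. (i, j) \<in> r}))"
    unfolding tails_def
  proof (rule eventually_INF_base)
    fix a b assume "a \<in> I" "b \<in> I"
    then obtain k where k: "k \<in> I" "(a, k) \<in> r" "(b, k) \<in> r" using *(3) by blast
    then have "{j. (k, j) \<in> r} \<subseteq> {j. (a, j) \<in> r} \<inter> {j. (b, j) \<in> r}"
      using *(2) by (auto dest: transD)
    then show "\<exists>x\<in>I. principal {j. (x, j) \<in> r} \<le>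
        inf (principal {j. (a, j) \<in> r}) (principal {j. (b, j) \<in> r})"
      using k(1) by auto
  qed (use * in auto)
  then show ?thesis by (simp add: eventually_principal)
qed

text \<open>Subnets in the sense of Kelley: \<open>h\<close> reindexes and is eventually above each index.\<close>

definition subnet_map :: "'j set \<Rightarrow> 'j rel \<Rightarrow> ('j \<Rightarrow> 'i) \<Rightarrow> 'i set \<Rightarrow> 'i rel \<Rightarrow> bool" where
  "subnet_map J s h I r \<longleftrightarrow>
     directed_by J s \<and> h ` J \<subseteq> I \<and> (\<forall>i\<in>I. \<exists>j\<in>J. \<forall>k. (j, k) \<in> s \<longrightarrow> (i, h k) \<in> r)"

text \<open>For a net take the filter \<open>tails I r\<close>; for a family indexed by \<open>\<epsilon> \<rightarrow> 0\<close> with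
  \<open>\<epsilon> > 0\<close> take \<open>at_right 0\<close>.\<close>

definition Hausdorff_converges ::
    "('i \<Rightarrow> 'x::real_topological_vector set) \<Rightarrow> 'x set \<Rightarrow> 'i filter \<Rightarrow> bool" where
  "Hausdorff_converges M N F \<longleftrightarrow>
     (\<forall>U. 0 \<in> interior U \<longrightarrow> eventually (\<lambda>i. M i \<subseteq> N + U \<and> N \<subseteq> M i + U) F)"


section \<open>Well-posedness\<close>

definition minimizing_net ::
    "('x \<Rightarrow> 'z set) \<Rightarrow> ('z \<Rightarrow> ereal) set \<Rightarrow> 'i set \<Rightarrow> 'i rel \<Rightarrow> ('i \<Rightarrow> 'x set) \<Rightarrow> bool" where
  "minimizing_net f \<Psi> I r M \<longleftrightarrow>
     directed_by I r \<and>
     (\<forall>\<epsilon>>0. \<exists>i\<in>I. \<forall>j. (i, j) \<in> r \<longrightarrow> is_solution f \<epsilon> \<Psi> (M j))"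

text \<open>Well-posedness quantifies over nets and subnets with arbitrary index sets, which HOL cannot
  express directly.  \<open>well_posed_for TYPE('i) TYPE('j)\<close> takes the index sets of nets from \<open>'i\<close> and
  those of subnets from \<open>'j\<close>, and \<open>well_posed\<close> fixes \<open>'i\<close>, \<open>'j\<close> to types that are large enough
  for every \<open>'x\<close>: lemmas \<open>well_posed_imp_well_posed_for\<close> and \<open>well_posed_for_imp_well_posed\<close> below
  show that the choice loses no nets and no subnets.\<close>

definition well_posed_for ::
    "'i itself \<Rightarrow> 'j itself \<Rightarrow> ('x::real_topological_vector \<Rightarrow> 'z set) \<Rightarrow> ('z \<Rightarrow> ereal) set \<Rightarrow> bool" where
  "well_posed_for _ _ f \<Psi> \<longleftrightarrow>
     (\<exists>N. is_solution f 0 \<Psi> N) \<and>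
     (\<forall>(I :: 'i set) r M. minimizing_net f \<Psi> I r M \<longrightarrow>
        (\<exists>(J :: 'j set) s h N. subnet_map J s h I r \<and>
           Hausdorff_converges (\<lambda>j. M (h j)) N (tails J s) \<and> is_solution f 0 \<Psi> N))"

type_synonym 'x net_index = "'x set \<times> 'x set set"
type_synonym 'i subnet_index = "'i \<times> 'i set"

definition well_posed :: "('x::real_topological_vector \<Rightarrow> 'z set) \<Rightarrow> ('z \<Rightarrow> ereal) set \<Rightarrow> bool" where
  "well_posed f \<Psi> \<longleftrightarrow>
     well_posed_for TYPE('x net_index) TYPE('x net_index subnet_index) f \<Psi>"

text \<open>Every proper filter is the filter of tails of a net indexed by the pairs \<open>(a, S)\<close> with
  \<open>a \<in> S\<close> and \<open>S\<close> in the filter.\<close>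

definition filter_index :: "'a filter \<Rightarrow> ('a \<times> 'a set) set" where
  "filter_index F = {(a, S). a \<in> S \<and> eventually (\<lambda>b. b \<in> S) F}"

definition filter_index_rel :: "'a filter \<Rightarrow> ('a \<times> 'a set) rel" where
  "filter_index_rel F =
     {(p, q). p \<in> filter_index F \<and> q \<in> filter_index F \<and> snd q \<subseteq> snd p}"

lemma directed_filter_index:
  assumes "F \<noteq> bot"
  shows "directed_by (filter_index F) (filter_index_rel F)"
proof -
  have ne: "\<exists>a. a \<in> S" if "eventually (\<lambda>b. b \<in> S) F" for S
    using eventually_happens'[OF assms that] .
  have "filter_index F \<noteq> {}"
    using ne[of UNIV] by (auto simp: filter_index_def intro!: exI[of _ UNIV])
  moreover have "preorder_on (filter_index F) (filter_index_rel F)"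
    by (auto simp: preorder_on_def filter_index_rel_def refl_on_def trans_def)
  moreover have "\<exists>k\<in>filter_index F. (p, k) \<in> filter_index_rel F \<and> (q, k) \<in> filter_index_rel F"
    if "p \<in> filter_index F" "q \<in> filter_index F" for p q
  proof -
    have ev: "eventually (\<lambda>b. b \<in> snd p \<inter> snd q) F"
      using that by (auto simp: filter_index_def eventually_conj_iff)
    obtain a where "a \<in> snd p \<inter> snd q" using ne[OF ev] by blast
    then have "(a, snd p \<inter> snd q) \<in> filter_index F"
      using ev by (simp add: filter_index_def)
    then show ?thesis
      using that by (intro bexI[of _ "(a, snd p \<inter> snd q)"]) (auto simp: filter_index_rel_def)
  qed
  ultimately show ?thesis by (auto simp: directed_by_def)
qed

lemma filtermap_fst_filter_index:
  assumes "F \<noteq> bot"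
  shows "filtermap fst (tails (filter_index F) (filter_index_rel F)) = F"
proof (rule filter_eq_iff[THEN iffD2, rule_format])
  fix P
  have "eventually P (filtermap fst (tails (filter_index F) (filter_index_rel F))) \<longleftrightarrow>
      (\<exists>p\<in>filter_index F. \<forall>q. (p, q) \<in> filter_index_rel F \<longrightarrow> P (fst q))"
    by (simp add: eventually_filtermap eventually_tails[OF directed_filter_index[OF assms]])
  also have "\<dots> \<longleftrightarrow> eventually P F"
  proof
    assume "\<exists>p\<in>filter_index F. \<forall>q. (p, q) \<in> filter_index_rel F \<longrightarrow> P (fst q)"
    then obtain a S where p: "(a, S) \<in> filter_index F"
      and P: "\<And>q. ((a, S), q) \<in> filter_index_rel F \<Longrightarrow> P (fst q)" by (metis surj_pair)
    have "P b" if "b \<in> S" for b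
      using P[of "(b, S)"] p that by (auto simp: filter_index_rel_def filter_index_def)
    moreover have "eventually (\<lambda>b. b \<in> S) F" using p by (simp add: filter_index_def)
    ultimately show "eventually P F" by (auto elim: eventually_mono)
  next
    assume ev: "eventually P F"
    then obtain a where "P a" using eventually_happens'[OF assms] by blast
    then have "(a, {b. P b}) \<in> filter_index F" using ev by (simp add: filter_index_def)
    then show "\<exists>p\<in>filter_index F. \<forall>q. (p, q) \<in> filter_index_rel F \<longrightarrow> P (fst q)"
      by (intro bexI[of _ "(a, {b. P b})"]) (auto simp: filter_index_rel_def filter_index_def)
  qed
  finally show "eventually P (filtermap fst (tails (filter_index F) (filter_index_rel F)))
    \<longleftrightarrow> eventually P F" .
qed

lemma tails_neq_bot:
  assumes "directed_by I r"
  shows "tails I r \<noteq> bot"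
proof
  assume "tails I r = bot"
  then have "eventually (\<lambda>_. False) (tails I r)" by simp
  then obtain i where "i \<in> I" "\<forall>j. (i, j) \<notin> r" by (auto simp: eventually_tails[OF assms])
  moreover have "(i, i) \<in> r" if "i \<in> I"
    using assms that by (auto simp: directed_by_def preorder_on_def refl_on_def)
  ultimately show False by blast
qed

lemma minimizing_net_iff:
  "minimizing_net f \<Psi> I r M \<longleftrightarrow>
     directed_by I r \<and>
     (\<forall>\<epsilon>>0. eventually (is_solution f \<epsilon> \<Psi>) (filtermap M (tails I r)))"
  by (auto simp: minimizing_net_def eventually_filtermap eventually_tails)

lemma Hausdorff_converges_filtermap:
  "Hausdorff_converges (\<lambda>i. M (h i)) N F \<longleftrightarrow> Hausdorff_converges M N (filtermap h F)"
  by (simp add: Hausdorff_converges_def eventually_filtermap)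

lemma Hausdorff_converges_mono:
  "Hausdorff_converges M N G \<Longrightarrow> F \<le> G \<Longrightarrow> Hausdorff_converges M N F"
  by (auto simp: Hausdorff_converges_def dest: filter_leD)

lemma subnet_map_filtermap_le:
  assumes "subnet_map J s h I r" "directed_by I r"
  shows "filtermap h (tails J s) \<le> tails I r"
proof (rule filter_leI)
  fix P assume "eventually P (tails I r)"
  then obtain i where i: "i \<in> I" "\<And>j. (i, j) \<in> r \<Longrightarrow> P j"
    by (auto simp: eventually_tails[OF assms(2)])
  have J: "directed_by J s" using assms(1) by (simp add: subnet_map_def)
  obtain j where "j \<in> J" "\<And>k. (j, k) \<in> s \<Longrightarrow> (i, h k) \<in> r"
    using assms(1) i(1) unfolding subnet_map_def by meson
  then show "eventually P (filtermap h (tails J s))"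
    using i(2) by (auto simp: eventually_filtermap eventually_tails[OF J])
qed

text \<open>A proper filter on the index set refining the tails is realised by a subnet.\<close>

lemma subnet_of_filter:
  fixes H :: "'i filter"
  assumes "directed_by I r" "H \<noteq> bot" "H \<le> tails I r"
  shows "\<exists>(J :: 'i subnet_index set) s. subnet_map J s fst I r \<and> filtermap fst (tails J s) = H"
proof -
  define J where "J = filter_index H \<inter> {p. snd p \<subseteq> I}"
  define s where "s = filter_index_rel H \<inter> J \<times> J"
  have rI: "r \<subseteq> I \<times> I" using assms(1) by (simp add: directed_by_def preorder_on_def)
  have ev: "eventually (\<lambda>j. (i, j) \<in> r) H" if "i \<in> I" for i
  proof (rule filter_leD[OF assms(3)])
    show "eventually (\<lambda>j. (i, j) \<in> r) (tails I r)"
      using that by (auto simp: eventually_tails[OF assms(1)])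
  qed
  obtain i0 where i0: "i0 \<in> I" using assms(1) by (auto simp: directed_by_def)
  have evI: "eventually (\<lambda>j. j \<in> I) H"
    using ev[OF i0] by (rule eventually_mono) (use rI in auto)
  have inJ: "\<exists>a. (a, S) \<in> J" if "eventually (\<lambda>b. b \<in> S) H" "S \<subseteq> I" for S
    using eventually_happens'[OF assms(2) that(1)] that by (auto simp: J_def filter_index_def)
  have J: "directed_by J s"
    unfolding directed_by_def
  proof (intro conjI ballI)
    show "J \<noteq> {}" using inJ[OF evI] by auto
    show "preorder_on J s"
      by (auto simp: preorder_on_def s_def J_def filter_index_rel_def refl_on_def trans_def)
  next
    fix p q assume pq: "p \<in> J" "q \<in> J"
    then have "eventually (\<lambda>b. b \<in> snd p \<inter> snd q) H" "snd p \<inter> snd q \<subseteq> I"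
      by (auto simp: J_def filter_index_def eventually_conj_iff)
    from inJ[OF this] obtain a where a: "(a, snd p \<inter> snd q) \<in> J" by blast
    then show "\<exists>k\<in>J. (p, k) \<in> s \<and> (q, k) \<in> s"
      using pq by (intro bexI[OF _ a]) (auto simp: s_def J_def filter_index_rel_def)
  qed
  have "subnet_map J s fst I r"
    unfolding subnet_map_def
  proof (intro conjI ballI J)
    show "fst ` J \<subseteq> I" by (auto simp: J_def filter_index_def)
  next
    fix i assume "i \<in> I"
    have "eventually (\<lambda>b. b \<in> {j. (i, j) \<in> r}) H" using ev[OF \<open>i \<in> I\<close>] by simp
    moreover have "{j. (i, j) \<in> r} \<subseteq> I" using rI by auto
    ultimately obtain a where "(a, {j. (i, j) \<in> r}) \<in> J" using inJ by blast
    then show "\<exists>j\<in>J. \<forall>k. (j, k) \<in> s \<longrightarrow> (i, fst k) \<in> r"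
      by (intro bexI[of _ "(a, {j. (i, j) \<in> r})"])
        (auto simp: s_def J_def filter_index_rel_def filter_index_def)
  qed
  moreover have "filtermap fst (tails J s) = H"
  proof (rule filter_eq_iff[THEN iffD2, rule_format])
    fix P
    have "eventually P (filtermap fst (tails J s)) \<longleftrightarrow> (\<exists>p\<in>J. \<forall>q. (p, q) \<in> s \<longrightarrow> P (fst q))"
      by (simp add: eventually_filtermap eventually_tails[OF J])
    also have "\<dots> \<longleftrightarrow> eventually P H"
    proof
      assume "\<exists>p\<in>J. \<forall>q. (p, q) \<in> s \<longrightarrow> P (fst q)"
      then obtain a S where p: "(a, S) \<in> J" and P: "\<And>q. ((a, S), q) \<in> s \<Longrightarrow> P (fst q)"
        by (metis surj_pair)
      have "P b" if "b \<in> S" for b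
        using P[of "(b, S)"] p that by (auto simp: s_def J_def filter_index_rel_def filter_index_def)
      moreover have "eventually (\<lambda>b. b \<in> S) H" using p by (simp add: J_def filter_index_def)
      ultimately show "eventually P H" by (auto elim: eventually_mono)
    next
      assume "eventually P H"
      then have "eventually (\<lambda>b. b \<in> {b \<in> I. P b}) H" using evI by (simp add: eventually_conj_iff)
      then obtain a where "(a, {b \<in> I. P b}) \<in> J" using inJ[of "{b \<in> I. P b}"] by blast
      then show "\<exists>p\<in>J. \<forall>q. (p, q) \<in> s \<longrightarrow> P (fst q)"
        by (intro bexI[of _ "(a, {b \<in> I. P b})"])
          (auto simp: s_def J_def filter_index_rel_def filter_index_def)
    qed
    finally show "eventually P (filtermap fst (tails J s)) \<longleftrightarrow> eventually P H" .
  qed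
  ultimately show ?thesis by blast
qed

lemma well_posed_for_transfer:
  fixes f :: "'x::real_topological_vector \<Rightarrow> 'z set"
  assumes wp: "well_posed_for TYPE('x net_index) TYPE('j) f \<Psi>"
  shows "well_posed_for TYPE('i) TYPE('i subnet_index) f \<Psi>"
  unfolding well_posed_for_def
proof (intro conjI allI impI)
  show "\<exists>N. is_solution f 0 \<Psi> N" using wp by (simp add: well_posed_for_def)
next
  fix I :: "'i set" and r and M :: "'i \<Rightarrow> 'x set"
  assume min: "minimizing_net f \<Psi> I r M"
  define F where "F = filtermap M (tails I r)"
  have dir: "directed_by I r" using min by (simp add: minimizing_net_def)
  have F: "F \<noteq> bot" unfolding F_def by (simp add: filtermap_bot_iff tails_neq_bot[OF dir])
  have "minimizing_net f \<Psi> (filter_index F) (filter_index_rel F) fst"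
    using min unfolding minimizing_net_iff filtermap_fst_filter_index[OF F]
    by (simp add: directed_filter_index[OF F] flip: F_def)
  then obtain J :: "'j set" and s h N where sub: "subnet_map J s h (filter_index F) (filter_index_rel F)"
    and conv: "Hausdorff_converges (\<lambda>j. fst (h j)) N (tails J s)" and N: "is_solution f 0 \<Psi> N"
    using wp unfolding well_posed_for_def by blast
  define G where "G = filtermap (\<lambda>j. fst (h j)) (tails J s)"
  have J: "directed_by J s" using sub by (simp add: subnet_map_def)
  have G: "G \<noteq> bot" unfolding G_def by (simp add: filtermap_bot_iff tails_neq_bot[OF J])
  have "G = filtermap fst (filtermap h (tails J s))" by (simp add: G_def filtermap_filtermap)
  also have "\<dots> \<le> filtermap fst (tails (filter_index F) (filter_index_rel F))"
    by (intro filtermap_mono subnet_map_filtermap_le[OF sub] directed_filter_index[OF F])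
  finally have GF: "G \<le> F" by (simp add: filtermap_fst_filter_index[OF F])
  have convG: "Hausdorff_converges (\<lambda>A. A) N G"
    using conv Hausdorff_converges_filtermap[of "\<lambda>A. A" "\<lambda>j. fst (h j)"] by (simp add: G_def)
  define H where "H = inf (filtercomap M G) (tails I r)"
  have "H \<noteq> bot"
  proof
    assume "H = bot"
    then have "eventually (\<lambda>_. False) H" by simp
    then obtain P Q where P: "eventually P (filtercomap M G)" and Q: "eventually Q (tails I r)"
      and PQ: "\<And>i. P i \<Longrightarrow> Q i \<Longrightarrow> False"
      unfolding H_def eventually_inf by blast
    obtain R where R: "eventually R G" "\<And>i. R (M i) \<Longrightarrow> P i"
      using P by (auto simp: eventually_filtercomap)
    have "eventually (\<lambda>A. \<exists>i. A = M i \<and> Q i) F"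
      unfolding F_def eventually_filtermap using Q by (rule eventually_mono) auto
    then have "eventually (\<lambda>A. R A \<and> (\<exists>i. A = M i \<and> Q i)) G"
      using R(1) GF by (auto intro: eventually_conj dest: filter_leD)
    then show False using eventually_happens'[OF G] R(2) PQ by blast
  qed
  moreover have "H \<le> tails I r" by (simp add: H_def)
  ultimately obtain K :: "'i subnet_index set" and t where
    K: "subnet_map K t fst I r" and H: "filtermap fst (tails K t) = H"
    using subnet_of_filter[OF dir] by blast
  have "filtermap M H \<le> G"
  proof -
    have "filtermap M H \<le> filtermap M (filtercomap M G)"
      unfolding H_def by (intro filtermap_mono) simp
    also have "\<dots> \<le> G" by (rule filtermap_filtercomap)
    finally show ?thesis .
  qed
  then have "Hausdorff_converges (\<lambda>A. A) N (filtermap M H)"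
    by (rule Hausdorff_converges_mono[OF convG])
  then have "Hausdorff_converges (\<lambda>k. M (fst k)) N (tails K t)"
    by (simp add: Hausdorff_converges_def eventually_filtermap flip: H)
  then show "\<exists>(J :: 'i subnet_index set) s h N. subnet_map J s h I r \<and>
      Hausdorff_converges (\<lambda>j. M (h j)) N (tails J s) \<and> is_solution f 0 \<Psi> N"
    using K N by blast
qed

lemma well_posed_imp_well_posed_for:
  fixes f :: "'x::real_topological_vector \<Rightarrow> 'z set"
  assumes "well_posed f \<Psi>"
  shows "well_posed_for TYPE('i) TYPE('i subnet_index) f \<Psi>"
  using assms unfolding well_posed_def by (rule well_posed_for_transfer)

lemma well_posed_for_imp_well_posed:
  fixes f :: "'x::real_topological_vector \<Rightarrow> 'z set"
  assumes "well_posed_for TYPE('x net_index) TYPE('j) f \<Psi>"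
  shows "well_posed f \<Psi>"
  unfolding well_posed_def by (rule well_posed_for_transfer[OF assms])

end

theory Submission
  imports Defs
begin

text \<open>
  Two monotonicity properties carry the proof. The bound \<open>eps_bound \<Psi> f \<epsilon> \<psi>\<close> grows with \<open>\<epsilon> \<ge> 0\<close>,
  hence so does \<open>Minimizers f \<epsilon> \<Psi>\<close>; and enlarging a solution by further approximate minimizers
  only lowers its infimum, so the result is again a solution (lemma \<open>is_solution_enlarge\<close>).

  Well-posedness provides some \<open>0\<close>-solution \<open>N\<^sub>0\<close>. Enlarging \<open>N\<^sub>0\<close> shows that \<open>Minimizers f 0 \<Psi>\<close> is a
  \<open>0\<close>-solution, and that the sets \<open>Minimizers f \<epsilon> \<Psi>\<close>, indexed by the positive reals directed
  downwards, form a minimizing net. A subnet of it therefore converges to a \<open>0\<close>-solution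
  \<open>N \<subseteq> Minimizers f 0 \<Psi>\<close>. Given a neighbourhood \<open>U\<close> of \<open>0\<close>, a single member of the subnet
  yields some \<open>\<delta> > 0\<close> with \<open>Minimizers f \<delta> \<Psi> \<subseteq> N + U \<subseteq> Minimizers f 0 \<Psi> + U\<close>, and by
  monotonicity this inclusion persists for all smaller \<open>\<epsilon>\<close>. Because the family is
  monotone, one convergent subnet thus controls all of it. The other inclusion required by Hausdorff
  convergence is \<open>Minimizers f 0 \<Psi> \<subseteq> Minimizers f \<epsilon> \<Psi>\<close>.
\<close>

lemma psi_inf_antimono: "D \<subseteq> E \<Longrightarrow> psi_inf \<psi> E \<le> psi_inf \<psi> D"
  unfolding psi_inf_def by (rule INF_superset_mono) auto

lemma cl_Psi_mono: "D \<subseteq> E \<Longrightarrow> cl_Psi \<Psi> D \<subseteq> cl_Psi \<Psi> E"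
  unfolding cl_Psi_def by (blast intro: order_trans[OF psi_inf_antimono])

lemma inf_image_mono: "M \<subseteq> N \<Longrightarrow> inf_image \<Psi> f M \<subseteq> inf_image \<Psi> f N"
  unfolding inf_image_def by (intro cl_Psi_mono UN_mono) auto

lemma eps_bound_mono:
  assumes "0 \<le> \<epsilon>" "\<epsilon> \<le> \<delta>"
  shows "eps_bound \<Psi> f \<epsilon> \<psi> \<le> eps_bound \<Psi> f \<delta> \<psi>"
proof -
  have "- (1 / \<epsilon>) \<le> - (1 / \<delta>)" if "\<epsilon> \<noteq> 0"
    using assms that by (simp add: frac_le)
  moreover have "a + ereal \<epsilon> \<le> a + ereal \<delta>" for a
    using assms by (intro add_left_mono) simp
  ultimately show ?thesis using assms by (force simp: eps_bound_def zero_ereal_def)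
qed

lemma Minimizers_mono:
  assumes "0 \<le> \<epsilon>" "\<epsilon> \<le> \<delta>"
  shows "Minimizers f \<epsilon> \<Psi> \<subseteq> Minimizers f \<delta> \<Psi>"
  unfolding Minimizers_def by (blast intro: order_trans[OF _ eps_bound_mono[OF assms]])

text \<open>
  The two clauses that define a solution pull in opposite directions as the set grows: the
  condition on the infimum is inherited by supersets, whereas the containment in the approximate
  minimizers limits how far the set may be enlarged.
\<close>

lemma is_solution_enlarge:
  assumes sol: "is_solution f \<epsilon> \<Psi> N" and "0 \<le> \<epsilon>" "\<epsilon> \<le> \<delta>"
    and "N \<subseteq> M" "M \<subseteq> Minimizers f \<delta> \<Psi>"
  shows "is_solution f \<delta> \<Psi> M"
  unfolding is_solution_def
proof (intro conjI ballI)
  show "M \<noteq> {}" using sol \<open>N \<subseteq> M\<close> by (auto simp: is_solution_def)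
next
  fix \<psi> assume "\<psi> \<in> \<Psi>"
  have "psi_inf \<psi> (inf_image \<Psi> f M) \<le> psi_inf \<psi> (inf_image \<Psi> f N)"
    by (intro psi_inf_antimono inf_image_mono \<open>N \<subseteq> M\<close>)
  also have "\<dots> \<le> eps_bound \<Psi> f \<epsilon> \<psi>"
    using sol \<open>\<psi> \<in> \<Psi>\<close> by (simp add: is_solution_def)
  also have "\<dots> \<le> eps_bound \<Psi> f \<delta> \<psi>"
    by (rule eps_bound_mono) fact+
  finally show "psi_inf \<psi> (inf_image \<Psi> f M) \<le> eps_bound \<Psi> f \<delta> \<psi>" .
qed fact

definition pos_real_downward :: "real rel" where
  "pos_real_downward = {(\<epsilon>, \<delta>). 0 < \<delta> \<and> \<delta> \<le> \<epsilon>}"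

lemma directed_by_pos_real_downward: "directed_by {0<..} pos_real_downward"
  unfolding directed_by_def
proof (intro conjI ballI)
  show "preorder_on {0<..} pos_real_downward"
    by (auto simp: preorder_on_def refl_on_def trans_def pos_real_downward_def)
next
  fix \<epsilon> \<delta> :: real assume "\<epsilon> \<in> {0<..}" "\<delta> \<in> {0<..}"
  then show "\<exists>\<eta>\<in>{0<..}. (\<epsilon>, \<eta>) \<in> pos_real_downward \<and> (\<delta>, \<eta>) \<in> pos_real_downward"
    by (intro bexI[of _ "min \<epsilon> \<delta>"]) (auto simp: pos_real_downward_def)
qed auto

lemma minimizing_net_Minimizers:
  assumes "is_solution f 0 \<Psi> N"
  shows "minimizing_net f \<Psi> {0<..} pos_real_downward (\<lambda>\<epsilon>. Minimizers f \<epsilon> \<Psi>)"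
  unfolding minimizing_net_def
proof (intro conjI allI impI)
  fix \<epsilon> :: real assume "0 < \<epsilon>"
  have "is_solution f \<epsilon> \<Psi> (Minimizers f \<delta> \<Psi>)" if "0 < \<delta>" "\<delta> \<le> \<epsilon>" for \<delta>
  proof (rule is_solution_enlarge[OF assms])
    have "N \<subseteq> Minimizers f 0 \<Psi>" using assms by (simp add: is_solution_def)
    also have "\<dots> \<subseteq> Minimizers f \<delta> \<Psi>" using that by (intro Minimizers_mono) auto
    finally show "N \<subseteq> Minimizers f \<delta> \<Psi>" .
    show "Minimizers f \<delta> \<Psi> \<subseteq> Minimizers f \<epsilon> \<Psi>" using that by (intro Minimizers_mono) auto
  qed (use \<open>0 < \<epsilon>\<close> in auto)
  then show "\<exists>i\<in>{0<..}. \<forall>\<delta>. (i, \<delta>) \<in> pos_real_downward \<longrightarrow>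
      is_solution f \<epsilon> \<Psi> (Minimizers f \<delta> \<Psi>)"
    using \<open>0 < \<epsilon>\<close> by (intro bexI[of _ \<epsilon>]) (auto simp: pos_real_downward_def)
qed (rule directed_by_pos_real_downward)

text \<open>
  By monotonicity of the family, one member of the subnet that lies in \<open>N + U\<close> bounds all later
  sets from above. This is the only inclusion to be extracted from the subnet, which is why its
  limit may be smaller than \<open>Minimizers f 0 \<Psi>\<close>.
\<close>

lemma Hausdorff_converges_Minimizers:
  fixes f :: "'x::real_topological_vector \<Rightarrow> 'z set"
  assumes sub: "subnet_map J s h {0<..} pos_real_downward"
    and conv: "Hausdorff_converges (\<lambda>j. Minimizers f (h j) \<Psi>) N (tails J s)"
    and N: "N \<subseteq> Minimizers f 0 \<Psi>"
  shows "Hausdorff_converges (\<lambda>\<epsilon>. Minimizers f \<epsilon> \<Psi>) (Minimizers f 0 \<Psi>) (at_right 0)"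
  unfolding Hausdorff_converges_def
proof (intro allI impI)
  fix U :: "'x set" assume U: "0 \<in> interior U"
  have J: "directed_by J s" using sub by (simp add: subnet_map_def)
  have "eventually (\<lambda>j. Minimizers f (h j) \<Psi> \<subseteq> N + U) (tails J s)"
    using conv U unfolding Hausdorff_converges_def by (blast intro: eventually_mono)
  then obtain j where "j \<in> J" and "\<forall>k. (j, k) \<in> s \<longrightarrow> Minimizers f (h k) \<Psi> \<subseteq> N + U"
    by (auto simp: eventually_tails[OF J])
  moreover have "(j, j) \<in> s"
    using J \<open>j \<in> J\<close> by (auto simp: directed_by_def preorder_on_def refl_on_def)
  ultimately have j: "Minimizers f (h j) \<Psi> \<subseteq> N + U" by blast
  have "0 < h j" using sub \<open>j \<in> J\<close> by (auto simp: subnet_map_def)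
  then have "eventually (\<lambda>\<epsilon>. \<epsilon> \<in> {0<..<h j}) (at_right 0)"
    by (rule eventually_at_right_real)
  then show "eventually (\<lambda>\<epsilon>. Minimizers f \<epsilon> \<Psi> \<subseteq> Minimizers f 0 \<Psi> + U \<and>
      Minimizers f 0 \<Psi> \<subseteq> Minimizers f \<epsilon> \<Psi> + U) (at_right 0)"
  proof (rule eventually_mono)
    fix \<epsilon> assume \<epsilon>: "\<epsilon> \<in> {0<..<h j}"
    have "Minimizers f \<epsilon> \<Psi> \<subseteq> Minimizers f (h j) \<Psi>"
      using \<epsilon> by (intro Minimizers_mono) auto
    also note j
    also have "N + U \<subseteq> Minimizers f 0 \<Psi> + U" using N by (rule set_plus_mono2) simp
    finally have upper: "Minimizers f \<epsilon> \<Psi> \<subseteq> Minimizers f 0 \<Psi> + U" .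
    have "0 \<in> U" using U interior_subset by blast
    have "Minimizers f 0 \<Psi> \<subseteq> Minimizers f \<epsilon> \<Psi>"
      using \<epsilon> by (intro Minimizers_mono) auto
    also have "\<dots> \<subseteq> Minimizers f \<epsilon> \<Psi> + U"
      by (subst add.commute) (rule set_zero_plus2[OF \<open>0 \<in> U\<close>])
    finally show "Minimizers f \<epsilon> \<Psi> \<subseteq> Minimizers f 0 \<Psi> + U \<and>
        Minimizers f 0 \<Psi> \<subseteq> Minimizers f \<epsilon> \<Psi> + U"
      using upper by blast
  qed
qed

theorem proposition4p11:
  fixes f :: "'x::{real_topological_vector, t2_space} \<Rightarrow> 'z::preorder set"
    and \<Psi> :: "('z \<Rightarrow> ereal) set"
  assumes "\<forall>\<psi>\<in>\<Psi>. monotone (\<le>) (\<le>) \<psi>"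
    and "\<forall>x. f x \<in> closed_family \<Psi>"
    and "well_posed f \<Psi>"
  shows "Minimizers f 0 \<Psi> \<noteq> {} \<and>
         is_solution f 0 \<Psi> (Minimizers f 0 \<Psi>) \<and>
         Hausdorff_converges (\<lambda>\<epsilon>. Minimizers f \<epsilon> \<Psi>) (Minimizers f 0 \<Psi>) (at_right 0)"
proof -
  have wp: "well_posed_for TYPE(real) TYPE(real subnet_index) f \<Psi>"
    using assms(3) by (rule well_posed_imp_well_posed_for)
  then obtain N\<^sub>0 where N\<^sub>0: "is_solution f 0 \<Psi> N\<^sub>0"
    by (auto simp: well_posed_for_def)
  have sol: "is_solution f 0 \<Psi> (Minimizers f 0 \<Psi>)"
    using N\<^sub>0 by (rule is_solution_enlarge) (use N\<^sub>0 in \<open>auto simp: is_solution_def\<close>)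
  obtain J :: "real subnet_index set" and s h N
    where sub: "subnet_map J s h {0<..} pos_real_downward"
      and conv: "Hausdorff_converges (\<lambda>j. Minimizers f (h j) \<Psi>) N (tails J s)"
      and N: "is_solution f 0 \<Psi> N"
    using wp minimizing_net_Minimizers[OF N\<^sub>0] unfolding well_posed_for_def by blast
  have "N \<subseteq> Minimizers f 0 \<Psi>" using N by (simp add: is_solution_def)
  then have "Hausdorff_converges (\<lambda>\<epsilon>. Minimizers f \<epsilon> \<Psi>) (Minimizers f 0 \<Psi>) (at_right 0)"
    by (rule Hausdorff_converges_Minimizers[OF sub conv])
  moreover have "Minimizers f 0 \<Psi> \<noteq> {}" using sol by (simp add: is_solution_def)
  ultimately show ?thesis using sol by blast
qed

end
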